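(* For integers $n\ge 1$ and $k\ge 1$, let $M_{n,2k}$ be the number of $n\times 2k$ matrices with entries in $\{+1,-1\}$ such that each row contains exactly $k$ entries $+1$ and $k$ entries $-1$, and no two columns are identical. Then for each fixed integer $k\ge 3$ there exists $N$ such that for all $n\ge N$, \[ M_{n,2k}^2>M_{n-1,2k}\,M_{n+1,2k}. \] *)

theory Defs
  imports "Jordan_Normal_Form.Matrix"
begin

definition balanced_sign_mats :: "nat \<Rightarrow> nat \<Rightarrow> int mat set" where
  "balanced_sign_mats n k =
    {A \<in> carrier_mat n (2 * k).
       (\<forall>i<n. \<forall>j<2 * k. A $$ (i, j) \<in> {1, -1}) \<and>
       (\<forall>i<n. card {j. j < 2 * k \<and> A $$ (i, j) = 1} = k \<and>
              card {j. j < 2 * k \<and> A $$ (i, j) = -1} = k) \<and>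
       (\<forall>j<2 * k. \<forall>j'<2 * k. j \<noteq> j' \<longrightarrow> col A j \<noteq> col A j')}"

text \<open>\<open>num_balanced n k\<close> is $M_{n,2k}$: the second argument is half the number of columns.
  The set counted is finite, so \<^const>\<open>card\<close> has its usual meaning.\<close>

definition num_balanced :: "nat \<Rightarrow> nat \<Rightarrow> nat" where
  "num_balanced n k = card (balanced_sign_mats n k)"

end

theory Submission
  imports Defs Complex_Main "HOL-Library.FuncSet"
begin

text \<open>
  Identify a row with the \<open>k\<close>-subset of columns on which it is \<open>+1\<close>. There are \<open>c\<close> rows,
  of which \<open>b < c\<close> agree on two given columns, independently of the choice of these columns.
  If \<open>k \<ge> 3\<close>, fewer than \<open>b\<close> rows agree on each of two given pairs of columns, so the
  Bonferroni inequalities give \<open>M\<^sub>n = c\<^sup>n - P b\<^sup>n + O((b - 1)\<^sup>n)\<close>, where \<open>P\<close> is the number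
  of pairs of columns. For this sequence \<open>M\<^sub>n\<^sup>2 - M\<^sub>n\<^sub>-\<^sub>1 M\<^sub>n\<^sub>+\<^sub>1\<close> is
  \<open>P (c - b)\<^sup>2 (c b)\<^sup>n\<^sup>-\<^sup>1\<close> up to \<open>O((c (b - 1))\<^sup>n)\<close>.
\<close>

section \<open>Log-concavity of perturbed differences of two exponentials\<close>

lemma eventually_strictly_log_concave:
  fixes M :: "nat \<Rightarrow> real" and b c d K P :: real
  assumes d: "0 \<le> d" "d < b" and bc: "b < c" and P: "P > 0"
    and approx: "\<And>n. \<bar>M n - (c ^ n - P * b ^ n)\<bar> \<le> K * d ^ n"
  shows "\<exists>N. \<forall>n\<ge>N. M n * M (n + 2) < (M (n + 1))\<^sup>2"
proof -
  define u where "u n = c ^ n - P * b ^ n" for n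
  define e where "e n = M n - u n" for n
  have K: "K \<ge> 0" using approx[of 0] by simp
  \<comment> \<open>The shift \<open>i\<close> is paid for in powers of \<open>c > d\<close>. Every
    error product in \<open>rest\<close> is then a constant times
    \<open>(c * d) ^ n * c\<^sup>2\<close>.\<close>
  have e: "\<bar>e (n + i)\<bar> \<le> K * d ^ n * c ^ i" for n i
  proof -
    have "\<bar>e (n + i)\<bar> \<le> K * d ^ (n + i)"
      using approx by (simp add: e_def u_def)
    also have "\<dots> \<le> K * (d ^ n * c ^ i)"
      using d bc K by (auto simp: power_add intro!: mult_left_mono power_mono)
    finally show ?thesis by (simp add: mult.assoc)
  qed
  have u: "\<bar>u n\<bar> \<le> (1 + P) * c ^ n" for n
  proof -
    have "b ^ n \<le> c ^ n" using d bc by (intro power_mono) auto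
    then have "P * b ^ n \<le> P * c ^ n" "0 \<le> P * b ^ n" "0 \<le> c ^ n"
      using P d bc by (auto intro: mult_left_mono)
    then show ?thesis unfolding u_def by (simp add: algebra_simps)
  qed
  have M: "\<bar>M n\<bar> \<le> (1 + P + K) * c ^ n" for n
    using u[of n] e[of 0 n] by (simp add: e_def algebra_simps)
  \<comment> \<open>The last factor adds the constants of the three products in \<open>rest\<close>:
    \<open>2 + 2 * P + K\<close>, \<open>1 + P + K\<close> and \<open>1 + P\<close>.\<close>
  define L where "L = K * c\<^sup>2 * (4 + 4 * P + 2 * K)"
  have rest: "\<bar>e (n + 1) * (M (n + 1) + u (n + 1)) - e n * M (n + 2) - u n * e (n + 2)\<bar>
      \<le> L * (c * d) ^ n" for n
  proof -
    have "\<bar>M (n + 1) + u (n + 1)\<bar> \<le> (2 + 2 * P + K) * c ^ (n + 1)"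
      using M[of "n + 1"] u[of "n + 1"] by (simp add: algebra_simps)
    then have "\<bar>e (n + 1)\<bar> * \<bar>M (n + 1) + u (n + 1)\<bar>
        \<le> (K * d ^ n * c ^ 1) * ((2 + 2 * P + K) * c ^ (n + 1))"
      using e[of n 1] K d bc by (intro mult_mono) auto
    moreover have "\<bar>e n\<bar> * \<bar>M (n + 2)\<bar> \<le> (K * d ^ n * c ^ 0) * ((1 + P + K) * c ^ (n + 2))"
      using e[of n 0] M[of "n + 2"] K d bc by (intro mult_mono) auto
    moreover have "\<bar>u n\<bar> * \<bar>e (n + 2)\<bar> \<le> ((1 + P) * c ^ n) * (K * d ^ n * c ^ 2)"
      using e[of n 2] u[of n] P d bc by (intro mult_mono) auto
    moreover have "L * (c * d) ^ n = (K * d ^ n * c ^ 1) * ((2 + 2 * P + K) * c ^ (n + 1))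
        + (K * d ^ n * c ^ 0) * ((1 + P + K) * c ^ (n + 2))
        + ((1 + P) * c ^ n) * (K * d ^ n * c ^ 2)"
      by (simp add: L_def power_mult_distrib power_add algebra_simps power2_eq_square)
    ultimately show ?thesis
      unfolding abs_mult[symmetric] by linarith
  qed
  \<comment> \<open>The pure powers of \<open>c\<close> and of \<open>b\<close> cancel; the cross
    terms leave \<open>P * (c * b) ^ n\<close> times
    \<open>c\<^sup>2 - 2 * b * c + b\<^sup>2\<close>.\<close>
  have main: "(u (n + 1))\<^sup>2 - u n * u (n + 2) = P * (c - b)\<^sup>2 * (c * b) ^ n" for n
    by (simp add: u_def power_mult_distrib power_add algebra_simps power2_eq_square)
  \<comment> \<open>Substituting \<open>M = u + e\<close> only partly leaves each correction term
    with an explicit factor \<open>e\<close> and a cofactor of order \<open>c ^ n\<close>.\<close>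
  have diff: "(M (n + 1))\<^sup>2 - M n * M (n + 2) = ((u (n + 1))\<^sup>2 - u n * u (n + 2))
      + (e (n + 1) * (M (n + 1) + u (n + 1)) - e n * M (n + 2) - u n * e (n + 2))" for n
    by (simp add: e_def algebra_simps power2_eq_square)
  \<comment> \<open>After division by \<open>(c * b) ^ n\<close> the error bound is geometric with
    ratio \<open>d / b < 1\<close>, while the main term is a positive constant.\<close>
  have "(\<lambda>n. L * (d / b) ^ n) \<longlonglongrightarrow> L * 0"
    using d by (intro tendsto_mult tendsto_const LIMSEQ_power_zero) auto
  moreover have "0 < P * (c - b)\<^sup>2" using P bc by simp
  ultimately have "\<forall>\<^sub>F n in sequentially. L * (d / b) ^ n < P * (c - b)\<^sup>2"
    by (intro order_tendstoD(2)) auto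
  then obtain N where N: "\<And>n. n \<ge> N \<Longrightarrow> L * (d / b) ^ n < P * (c - b)\<^sup>2"
    by (auto simp: eventually_sequentially)
  have "M n * M (n + 2) < (M (n + 1))\<^sup>2" if "n \<ge> N" for n
  proof -
    have "L * (d / b) ^ n * (c * b) ^ n < P * (c - b)\<^sup>2 * (c * b) ^ n"
      using N[OF that] d bc by (intro mult_strict_right_mono) auto
    moreover have "(d / b) ^ n * (c * b) ^ n = (c * d) ^ n"
      using d unfolding power_mult_distrib[symmetric] by (simp add: mult.commute)
    ultimately have "L * (c * d) ^ n < P * (c - b)\<^sup>2 * (c * b) ^ n"
      by (simp add: mult.assoc)
    then show ?thesis
      using diff[of n] rest[of n] main[of n] by linarith
  qed
  then show ?thesis by blast
qed

section \<open>A lower Bonferroni bound for unions\<close>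

text \<open>A set added to \<open>m\<close> others loses at most \<open>m * d\<close> elements to
  their union. The losses sum to at most \<open>d\<close> times the number of pairs; the square is a
  cruder bound that suits the induction, as it grows by \<open>2 * m + 1\<close>.\<close>

lemma sum_card_le_card_UN:
  assumes "finite I" and "\<And>i. i \<in> I \<Longrightarrow> finite (A i)"
    and "\<And>i j. i \<in> I \<Longrightarrow> j \<in> I \<Longrightarrow> i \<noteq> j \<Longrightarrow> card (A i \<inter> A j) \<le> d"
  shows "(\<Sum>i\<in>I. card (A i)) \<le> card (\<Union>i\<in>I. A i) + (card I)\<^sup>2 * d"
  using assms
proof (induction I rule: finite_induct)
  case empty
  then show ?case by simp
next
  case (insert a I)
  let ?U = "\<Union>i\<in>I. A i"
  have IH: "(\<Sum>i\<in>I. card (A i)) \<le> card ?U + (card I)\<^sup>2 * d"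
    using insert by auto
  have "A a \<inter> ?U = (\<Union>i\<in>I. A a \<inter> A i)" by blast
  then have "card (A a \<inter> ?U) \<le> (\<Sum>i\<in>I. card (A a \<inter> A i))"
    using card_UN_le[OF insert.hyps(1)] by metis
  also have "\<dots> \<le> card I * d"
    using insert by (intro sum_bounded_above[where 'a=nat, simplified]) auto
  finally have "card (A a \<inter> ?U) \<le> card I * d" .
  moreover have "card (A a) + card ?U = card (A a \<union> ?U) + card (A a \<inter> ?U)"
    using insert by (intro card_Un_Int) auto
  moreover have "(card (insert a I))\<^sup>2 * d = (card I)\<^sup>2 * d + 2 * (card I * d) + d"
    using insert by (simp add: power2_eq_square algebra_simps)
  ultimately show ?case
    using IH insert.hyps by simp
qed

section \<open>Rows as sets, and rows that agree on pairs of columns\<close>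

definition sign_rows :: "nat \<Rightarrow> nat set set" where
  "sign_rows k = {R. R \<subseteq> {..<2 * k} \<and> card R = k}"

definition rows_eq :: "nat \<Rightarrow> nat \<times> nat \<Rightarrow> nat set set" where
  "rows_eq k p = {R \<in> sign_rows k. fst p \<in> R \<longleftrightarrow> snd p \<in> R}"

text \<open>Pairs are increasing, so that distinct elements are distinct as unordered pairs;
  \<open>(i, j)\<close> and \<open>(j, i)\<close> would give the same
  \<open>rows_eq\<close>.\<close>

definition col_pairs :: "nat \<Rightarrow> (nat \<times> nat) set" where
  "col_pairs k = {(i, j). i < j \<and> j < 2 * k}"

lemma finite_sign_rows [simp]: "finite (sign_rows k)"
  by (rule finite_subset[of _ "Pow {..<2 * k}"]) (auto simp: sign_rows_def)

lemma finite_rows_eq [simp]: "finite (rows_eq k p)"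
  by (simp add: rows_eq_def)

lemma finite_col_pairs [simp]: "finite (col_pairs k)"
  by (rule finite_subset[of _ "{..<2 * k} \<times> {..<2 * k}"]) (auto simp: col_pairs_def)

text \<open>Rows avoiding both columns are the \<open>k\<close>-subsets of the other
  \<open>2 * k - 2\<close> columns. Complementation preserves size \<open>k\<close> and maps them
  bijectively to the rows containing both, hence the factor 2.\<close>

lemma card_rows_eq:
  assumes "p \<in> col_pairs k"
  shows "card (rows_eq k p) = 2 * ((2 * k - 2) choose k)"
proof -
  obtain i j where p: "p = (i, j)" "i < j" "j < 2 * k"
    using assms by (auto simp: col_pairs_def)
  let ?X = "{..<2 * k}"
  let ?S = "{R. R \<subseteq> ?X - {i, j} \<and> card R = k}"
  have card_compl: "card (?X - R) = k" if "R \<subseteq> ?X" "card R = k" for R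
    using that by (subst card_Diff_subset) (auto intro: finite_subset)
  have split: "rows_eq k p = ?S \<union> (\<lambda>R. ?X - R) ` ?S"
  proof (intro equalityI subsetI)
    fix R assume R: "R \<in> rows_eq k p"
    then have RX: "R \<subseteq> ?X" "card R = k" by (auto simp: rows_eq_def sign_rows_def)
    show "R \<in> ?S \<union> (\<lambda>R. ?X - R) ` ?S"
    proof (cases "i \<in> R")
      case True
      then have "?X - R \<in> ?S" "R = ?X - (?X - R)"
        using R RX card_compl[OF RX] p by (auto simp: rows_eq_def)
      then show ?thesis by blast
    next
      case False
      then show ?thesis using R RX p by (auto simp: rows_eq_def)
    qed
  next
    fix R assume "R \<in> ?S \<union> (\<lambda>R. ?X - R) ` ?S"
    then show "R \<in> rows_eq k p"
    proof
      assume "R \<in> ?S"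
      then show ?thesis using p by (auto simp: rows_eq_def sign_rows_def)
    next
      assume "R \<in> (\<lambda>R. ?X - R) ` ?S"
      then obtain T where T: "T \<subseteq> ?X - {i, j}" "card T = k" "R = ?X - T" by auto
      then have "card R = k" using card_compl[of T] by auto
      then show ?thesis using T p by (auto simp: rows_eq_def sign_rows_def)
    qed
  qed
  have fin: "finite ?S"
    by (rule finite_subset[of _ "Pow ?X"]) auto
  have "i \<notin> R" if "R \<in> ?S" for R using that by auto
  moreover have "i \<in> R" if "R \<in> (\<lambda>R. ?X - R) ` ?S" for R using that p by auto
  ultimately have disj: "?S \<inter> (\<lambda>R. ?X - R) ` ?S = {}" by blast
  have "inj_on (\<lambda>R. ?X - R) ?S"
    by (rule inj_on_inverseI[where g = "\<lambda>R. ?X - R"]) auto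
  then have "card (rows_eq k p) = 2 * card ?S"
    using fin disj by (simp add: split card_Un_disjoint card_image)
  also have "card ?S = card (?X - {i, j}) choose k"
    by (rule n_subsets) simp
  also have "card (?X - {i, j}) = 2 * k - 2"
    using p by (subst card_Diff_subset) auto
  finally show ?thesis .
qed

text \<open>Supplies the witnesses for the two strict inclusions below. There is room, since
  \<open>2 * k - 1 \<ge> k\<close> columns differ from \<open>v\<close>.\<close>

lemma ex_row:
  assumes "A \<subseteq> {..<2 * k}" "card A \<le> k" "v < 2 * k" "v \<notin> A"
  shows "\<exists>R\<in>sign_rows k. A \<subseteq> R \<and> v \<notin> R"
proof -
  have "\<exists>R. A \<subseteq> R \<and> R \<subseteq> {..<2 * k} - {v} \<and> card R = k"
    using assms by (intro exists_subset_between) auto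
  then show ?thesis by (auto simp: sign_rows_def)
qed

lemma card_rows_eq_less:
  assumes "p \<in> col_pairs k"
  shows "card (rows_eq k p) < card (sign_rows k)"
proof (rule psubset_card_mono)
  obtain R where "R \<in> sign_rows k" "fst p \<in> R" "snd p \<notin> R"
    using assms ex_row[of "{fst p}" k "snd p"] by (auto simp: col_pairs_def)
  then show "rows_eq k p \<subset> sign_rows k" by (auto simp: rows_eq_def)
qed simp

text \<open>Some column \<open>v\<close> of \<open>q\<close> lies outside \<open>p\<close>. A row
  that is positive on \<open>p\<close> and on the partner \<open>w\<close> of \<open>v\<close>, but
  negative at \<open>v\<close>, agrees on \<open>p\<close> and not on \<open>q\<close>. It may need
  three positive entries, hence \<open>k \<ge> 3\<close>; for \<open>k = 2\<close> complementary
  pairs are a counterexample.\<close>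

lemma card_rows_eq_inter_less:
  assumes "k \<ge> 3" "p \<in> col_pairs k" "q \<in> col_pairs k" "p \<noteq> q"
  shows "card (rows_eq k p \<inter> rows_eq k q) < card (rows_eq k p)"
proof (rule psubset_card_mono)
  obtain i j where p: "p = (i, j)" "i < j" "j < 2 * k"
    using assms by (auto simp: col_pairs_def)
  obtain v w where q: "q = (v, w) \<or> q = (w, v)" "v \<notin> {i, j}" "v \<noteq> w" "v < 2 * k" "w < 2 * k"
  proof -
    obtain s t where st: "q = (s, t)" "s < t" "t < 2 * k"
      using assms by (auto simp: col_pairs_def)
    then have "s \<notin> {i, j} \<or> t \<notin> {i, j}" using p assms(4) by auto
    then show thesis using that[of s t] that[of t s] st by auto
  qed
  \<comment> \<open>Only an upper bound, because \<open>w\<close> may be \<open>i\<close> or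
    \<open>j\<close>.\<close>
  have "card {i, j, w} \<le> 3" by (simp add: card_insert_if)
  then obtain R where "R \<in> sign_rows k" "{i, j, w} \<subseteq> R" "v \<notin> R"
    using ex_row[of "{i, j, w}" k v] p q assms(1) by auto
  then have "R \<in> rows_eq k p" "R \<notin> rows_eq k q"
    using p(1) q(1) unfolding rows_eq_def by auto
  then show "rows_eq k p \<inter> rows_eq k q \<subset> rows_eq k p" by blast
qed simp

section \<open>Matrices as choices of rows\<close>

text \<open>\<open>?F\<close> reads off the positive positions of each row and \<open>?G\<close>
  writes them back. Distinctness of columns becomes avoidance, for each pair, of the event that all
  rows agree on it; each event is a product set.\<close>

lemma num_balanced_eq:
  "num_balanced n k =
     card ((\<Pi>\<^sub>E i\<in>{..<n}. sign_rows k) - (\<Union>p\<in>col_pairs k. \<Pi>\<^sub>E i\<in>{..<n}. rows_eq k p))"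
    (is "_ = card ?T")
proof -
  let ?F = "\<lambda>A::int mat. \<lambda>i\<in>{..<n}. {j. j < 2 * k \<and> A $$ (i, j) = 1}"
  let ?G = "\<lambda>f. mat n (2 * k) (\<lambda>(i, j). if j \<in> f i then 1 else - 1 :: int)"
  \<comment> \<open>By symmetry in \<open>j\<close> and \<open>j'\<close>, increasing pairs can be
    replaced by all distinct ones, as in the condition on matrices.\<close>
  have T: "f \<in> ?T \<longleftrightarrow> f \<in> (\<Pi>\<^sub>E i\<in>{..<n}. sign_rows k) \<and>
      (\<forall>j<2 * k. \<forall>j'<2 * k. j \<noteq> j' \<longrightarrow> (\<exists>i<n. (j \<in> f i) \<noteq> (j' \<in> f i)))" for f
  proof (cases "f \<in> (\<Pi>\<^sub>E i\<in>{..<n}. sign_rows k)")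
    case True
    then have "f \<in> (\<Pi>\<^sub>E i\<in>{..<n}. rows_eq k p) \<longleftrightarrow> (\<forall>i<n. fst p \<in> f i \<longleftrightarrow> snd p \<in> f i)" for p
      by (auto simp: rows_eq_def PiE_iff)
    then have "f \<in> ?T \<longleftrightarrow> (\<forall>j j'. j < j' \<and> j' < 2 * k \<longrightarrow> (\<exists>i<n. (j \<in> f i) \<noteq> (j' \<in> f i)))"
      using True by (auto simp: col_pairs_def)
    also have "\<dots> \<longleftrightarrow> (\<forall>j<2 * k. \<forall>j'<2 * k. j \<noteq> j' \<longrightarrow> (\<exists>i<n. (j \<in> f i) \<noteq> (j' \<in> f i)))"
    proof (intro iffI allI impI)
      fix j j'
      assume *: "\<forall>j j'. j < j' \<and> j' < 2 * k \<longrightarrow> (\<exists>i<n. (j \<in> f i) \<noteq> (j' \<in> f i))"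
        and "j < 2 * k" "j' < 2 * k" "j \<noteq> j'"
      then show "\<exists>i<n. (j \<in> f i) \<noteq> (j' \<in> f i)"
        using *[rule_format, of j j'] *[rule_format, of j' j] by (cases j j' rule: linorder_cases) auto
    next
      fix j j'
      assume *: "\<forall>j<2 * k. \<forall>j'<2 * k. j \<noteq> j' \<longrightarrow> (\<exists>i<n. (j \<in> f i) \<noteq> (j' \<in> f i))"
        and "j < j' \<and> j' < 2 * k"
      then show "\<exists>i<n. (j \<in> f i) \<noteq> (j' \<in> f i)"
        by (auto intro: *[rule_format])
    qed
    finally show ?thesis using True by blast
  qed auto
  have col_eq: "col A j = col A j' \<longleftrightarrow> (\<forall>i<n. A $$ (i, j) = A $$ (i, j'))"
    if "A \<in> carrier_mat n (2 * k)" "j < 2 * k" "j' < 2 * k" for A :: "int mat" and j j'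
    using that by (auto simp: vec_eq_iff)
  have row_G: "{j. j < 2 * k \<and> ?G f $$ (i, j) = 1} = f i"
    "{j. j < 2 * k \<and> ?G f $$ (i, j) = -1} = {..<2 * k} - f i"
    if "f \<in> (\<Pi>\<^sub>E i\<in>{..<n}. sign_rows k)" "i < n" for f i
  proof -
    have "f i \<subseteq> {..<2 * k}" using that by (auto simp: sign_rows_def PiE_iff)
    then show "{j. j < 2 * k \<and> ?G f $$ (i, j) = 1} = f i"
      "{j. j < 2 * k \<and> ?G f $$ (i, j) = -1} = {..<2 * k} - f i"
      using that(2) by (auto split: if_splits)
  qed
  have "bij_betw ?F (balanced_sign_mats n k) ?T"
  proof (rule bij_betw_byWitness[where f' = ?G])
    show "\<forall>A\<in>balanced_sign_mats n k. ?G (?F A) = A"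
    proof
      fix A assume A: "A \<in> balanced_sign_mats n k"
      then have neg: "A $$ (i, j) = -1" if "A $$ (i, j) \<noteq> 1" "i < n" "j < 2 * k" for i j
        using that by (auto simp: balanced_sign_mats_def)
      then show "?G (?F A) = A"
        using A by (intro eq_matI) (auto simp: balanced_sign_mats_def neg)
    qed
    show "\<forall>f\<in>?T. ?F (?G f) = f"
    proof
      fix f assume "f \<in> ?T"
      then have f: "f \<in> (\<Pi>\<^sub>E i\<in>{..<n}. sign_rows k)" by blast
      then show "?F (?G f) = f"
        \<comment> \<open>At indices outside \<open>{..<n}\<close> both sides are
          \<open>undefined\<close>, as \<open>f\<close> is extensional.\<close>
        by (intro ext) (auto simp: row_G(1) PiE_iff extensional_def)
    qed
    show "?F ` balanced_sign_mats n k \<subseteq> ?T"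
    proof (intro image_subsetI)
      fix A assume A: "A \<in> balanced_sign_mats n k"
      then have carrier: "A \<in> carrier_mat n (2 * k)" by (simp add: balanced_sign_mats_def)
      have "\<exists>i<n. (j \<in> ?F A i) \<noteq> (j' \<in> ?F A i)" if j: "j < 2 * k" "j' < 2 * k" "j \<noteq> j'" for j j'
      proof -
        have "col A j \<noteq> col A j'" using A j by (simp add: balanced_sign_mats_def)
        then obtain i where i: "i < n" "A $$ (i, j) \<noteq> A $$ (i, j')"
          using col_eq[OF carrier] j by blast
        have "A $$ (i, j) \<in> {1, -1}" "A $$ (i, j') \<in> {1, -1}"
          using A i j unfolding balanced_sign_mats_def by blast+
        then have "(A $$ (i, j) = 1) \<noteq> (A $$ (i, j') = 1)" using i by auto
        then show ?thesis using i j by (intro exI[of _ i]) simp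
      qed
      moreover have "?F A \<in> (\<Pi>\<^sub>E i\<in>{..<n}. sign_rows k)"
        using A by (auto simp: balanced_sign_mats_def sign_rows_def)
      ultimately show "?F A \<in> ?T" unfolding T by blast
    qed
    show "?G ` ?T \<subseteq> balanced_sign_mats n k"
    proof (intro image_subsetI)
      fix f assume "f \<in> ?T"
      then have f: "f \<in> (\<Pi>\<^sub>E i\<in>{..<n}. sign_rows k)"
        and sep: "\<And>j j'. j < 2 * k \<Longrightarrow> j' < 2 * k \<Longrightarrow> j \<noteq> j' \<Longrightarrow> \<exists>i<n. (j \<in> f i) \<noteq> (j' \<in> f i)"
        unfolding T by blast+
      have card: "card {j. j < 2 * k \<and> ?G f $$ (i, j) = 1} = k"
        "card {j. j < 2 * k \<and> ?G f $$ (i, j) = -1} = k" if "i < n" for i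
      proof -
        have R: "f i \<subseteq> {..<2 * k}" "card (f i) = k"
          using f that by (auto simp: sign_rows_def PiE_iff)
        have "card ({..<2 * k} - f i) = k"
          using R by (subst card_Diff_subset) (auto intro: finite_subset)
        then show "card {j. j < 2 * k \<and> ?G f $$ (i, j) = 1} = k"
          "card {j. j < 2 * k \<and> ?G f $$ (i, j) = -1} = k"
          using R row_G[OF f that] by simp_all
      qed
      have "col (?G f) j \<noteq> col (?G f) j'" if j: "j < 2 * k" "j' < 2 * k" "j \<noteq> j'" for j j'
      proof -
        obtain i where "i < n" "(j \<in> f i) \<noteq> (j' \<in> f i)" using sep[OF j] by blast
        then have "?G f $$ (i, j) \<noteq> ?G f $$ (i, j')" using j by auto
        then show ?thesis using col_eq[of "?G f" j j'] j \<open>i < n\<close> by auto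
      qed
      then show "?G f \<in> balanced_sign_mats n k"
        unfolding balanced_sign_mats_def using card by auto
    qed
  qed
  then show ?thesis by (simp add: num_balanced_def bij_betw_same_card)
qed

section \<open>Asymptotics of the count, and the conclusion\<close>

text \<open>The union bound and \<open>sum_card_le_card_UN\<close> enclose the number of excluded
  row choices between \<open>P * b ^ n - P\<^sup>2 * (b - 1) ^ n\<close> and
  \<open>P * b ^ n\<close>.\<close>

lemma num_balanced_approx:
  assumes "k \<ge> 3"
  defines "b \<equiv> 2 * ((2 * k - 2) choose k)" and "P \<equiv> card (col_pairs k)"
  shows "\<bar>real (num_balanced n k) - (real (card (sign_rows k)) ^ n - real P * real b ^ n)\<bar>
    \<le> (real P)\<^sup>2 * real (b - 1) ^ n"
proof -
  let ?A = "\<lambda>p. \<Pi>\<^sub>E i\<in>{..<n}. rows_eq k p"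
  let ?U = "\<Union>p\<in>col_pairs k. ?A p"
  have fin: "finite (?A p)" for p by (intro finite_PiE) auto
  have card_A: "card (?A p) = b ^ n" if "p \<in> col_pairs k" for p
    using card_rows_eq[OF that] by (simp add: card_PiE b_def)
  then have sum: "(\<Sum>p\<in>col_pairs k. card (?A p)) = P * b ^ n"
    by (simp add: P_def)
  have "card (?A p \<inter> ?A q) \<le> (b - 1) ^ n"
    if "p \<in> col_pairs k" "q \<in> col_pairs k" "p \<noteq> q" for p q
  proof -
    have "?A p \<inter> ?A q = (\<Pi>\<^sub>E i\<in>{..<n}. rows_eq k p \<inter> rows_eq k q)"
      by (simp add: PiE_Int)
    then have "card (?A p \<inter> ?A q) = card (rows_eq k p \<inter> rows_eq k q) ^ n"
      by (simp add: card_PiE)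
    \<comment> \<open>Fewer than \<open>b\<close> rows agree on both pairs, so at most
      \<open>b - 1\<close> do: integrality separates the bases of the two powers.\<close>
    also have "\<dots> \<le> (b - 1) ^ n"
      using card_rows_eq_inter_less[OF assms(1) that] card_rows_eq[OF that(1)]
      by (intro power_mono) (auto simp: b_def)
    finally show ?thesis .
  qed
  then have lower: "P * b ^ n \<le> card ?U + P\<^sup>2 * (b - 1) ^ n"
    using sum_card_le_card_UN[of "col_pairs k" ?A "(b - 1) ^ n"] fin sum by (simp add: P_def)
  have upper: "card ?U \<le> P * b ^ n"
    using card_UN_le[of "col_pairs k" ?A] sum by simp
  have sub: "?U \<subseteq> (\<Pi>\<^sub>E i\<in>{..<n}. sign_rows k)"
    by (auto simp: PiE_iff rows_eq_def)
  have "finite (\<Pi>\<^sub>E i\<in>{..<n}. sign_rows k)" by (intro finite_PiE) auto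
  then have "card (\<Pi>\<^sub>E i\<in>{..<n}. sign_rows k) = num_balanced n k + card ?U"
    unfolding num_balanced_eq using sub
    by (metis card_Diff_subset card_mono finite_subset le_add_diff_inverse2)
  then have "card (sign_rows k) ^ n = num_balanced n k + card ?U"
    by (simp add: card_PiE)
  then have "real (card (sign_rows k)) ^ n = real (num_balanced n k) + real (card ?U)"
    by (metis of_nat_add of_nat_power)
  moreover have "real P * real b ^ n \<le> real (card ?U) + (real P)\<^sup>2 * real (b - 1) ^ n"
    using lower by (metis of_nat_add of_nat_le_iff of_nat_mult of_nat_power)
  moreover have "real (card ?U) \<le> real P * real b ^ n"
    using upper by (metis of_nat_le_iff of_nat_mult of_nat_power)
  ultimately show ?thesis by linarith
qed

theorem theorem3p4:
  fixes k :: nat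
  assumes "k \<ge> 3"
  shows "\<exists>N::nat. \<forall>n\<ge>N.
    (num_balanced n k)\<^sup>2 > num_balanced (n - 1) k * num_balanced (n + 1) k"
proof -
  define b where "b = 2 * ((2 * k - 2) choose k)"
  have pair: "(0, 1) \<in> col_pairs k" using assms by (simp add: col_pairs_def)
  \<comment> \<open>Holds because \<open>k \<le> 2 * k - 2\<close>. It makes
    \<open>real (b - 1) < real b\<close> despite truncated subtraction.\<close>
  have "b > 0" using assms by (simp add: b_def)
  moreover have "b < card (sign_rows k)"
    using card_rows_eq_less[OF pair] card_rows_eq[OF pair] by (simp add: b_def)
  moreover have "card (col_pairs k) > 0"
    using pair by (auto simp: card_gt_0_iff)
  ultimately have "\<exists>N. \<forall>n\<ge>N. real (num_balanced n k) * real (num_balanced (n + 2) k)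
      < (real (num_balanced (n + 1) k))\<^sup>2"
    using num_balanced_approx[OF assms, folded b_def]
    by (intro eventually_strictly_log_concave[where c = "real (card (sign_rows k))" and b = "real b"
          and d = "real (b - 1)" and P = "real (card (col_pairs k))"]) auto
  then obtain N where N: "\<And>n. n \<ge> N \<Longrightarrow>
      num_balanced n k * num_balanced (n + 2) k < (num_balanced (n + 1) k)\<^sup>2"
    by (metis of_nat_less_iff of_nat_mult of_nat_power)
  \<comment> \<open>Starting at \<open>N + 1\<close> keeps \<open>n - 1\<close> a true predecessor
    that is at least \<open>N\<close>.\<close>
  have "num_balanced (n - 1) k * num_balanced (n + 1) k < (num_balanced n k)\<^sup>2" if "n \<ge> N + 1" for n
    using N[of "n - 1"] that by simp
  then show ?thesis by blast
qed

end
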